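(* Let $\{P_\theta:\theta\in\mathbb{R}\}$ be a parametric model on $\mathbb{R}$, let $\epsilon_{\max}\in[0,1]$, and for each $\epsilon\in[0,\epsilon_{\max}]$ let $r_\epsilon>0$. Suppose that for some $\alpha\in(0,1/4)$ the testing functions $\{\phi_{\theta,\theta-r_\epsilon,\epsilon},\,\phi_{\theta,\theta+r_\epsilon,\epsilon}:\epsilon\in[0,\epsilon_{\max}],\theta\in\mathbb{R}\}$ satisfy, for each choice of sign $\pm$ separately, $$\text{(simultaneous Type-1 error)}\quad \sup_Q P_{\epsilon_{\max},\theta,Q}\Big(\sup_{\epsilon\in[0,\epsilon_{\max}]}\phi_{\theta,\theta\pm r_\epsilon,\epsilon}=1\Big)\le\alpha,$$ $$\text{(Type-2 error)}\quad \sup_Q P_{\epsilon,\theta\pm r_\epsilon,Q}\big(\phi_{\theta,\theta\pm r_\epsilon,\epsilon}=0\big)\le\alpha,$$ for all $\theta\in\mathbb{R}$ and $\epsilon\in[0,\epsilon_{\max}]$. Define $$\widehat{\mathrm{CI}}=\{\theta\in\mathbb{R}:\ \phi_{\theta,\theta-r_\epsilon,\epsilon}=\phi_{\theta,\theta+r_\epsilon,\epsilon}=0\ \text{for all }\epsilon\in[0,\epsilon_{\max}]\}.$$ Then $$\inf_{\epsilon\in[0,\epsilon_{\max}],\theta,Q}P_{\epsilon,\theta,Q}\big(\theta\in\widehat{\mathrm{CI}}\big)\ge 1-2\alpha.$$ If, in addition, $\widehat{\mathrm{CI}}$ is an interval, then $$\inf_{\epsilon\in[0,\epsilon_{\max}],\theta,Q}P_{\epsilon,\theta,Q}\big(|\widehat{\mathrm{CI}}|\le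 2r_\epsilon\big)\ge 1-4\alpha.$$
   Context: For $\epsilon\in[0,1]$, $\theta\in\mathbb{R}$ and an arbitrary probability distribution $Q$ on $\mathbb{R}$, $P_{\epsilon,\theta,Q}=(1-\epsilon)P_\theta+\epsilon Q$; the data are $X_1,\ldots,X_n\overset{iid}{\sim}P_{\epsilon,\theta,Q}$ and $P_{\epsilon,\theta,Q}(\cdot)$ of an event about the data is its probability under this sampling. A testing function is a $\{0,1\}$-valued measurable function of the data; $\phi_{\theta,\theta\pm r_\epsilon,\epsilon}$ is a test of $H_0: P\in\{P_{\epsilon_{\max},\theta,Q}:Q\}$ versus $H_1:P\in\{P_{\epsilon,\theta\pm r_\epsilon,Q}:Q\}$ from $n$ i.i.d. observations from $P$ (value 1 means reject $H_0$). Suprema over $Q$ are over all probability distributions on $\mathbb{R}$. Events are assumed measurable. $|\cdot|$ denotes length (Lebesgue measure); the empty set counts as an interval of length 0. *)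

theory Defs
  imports "HOL-Probability.Probability"
begin

definition contaminate :: "real \<Rightarrow> real measure \<Rightarrow> real measure \<Rightarrow> real measure" where
  "contaminate \<epsilon> P Q =
     measure_of UNIV (sets borel)
       (\<lambda>A. ennreal (1 - \<epsilon>) * emeasure P A + ennreal \<epsilon> * emeasure Q A)"

abbreviation data_space :: "nat \<Rightarrow> (nat \<Rightarrow> real) measure" where
  "data_space n \<equiv> Pi\<^sub>M {1..n} (\<lambda>_. borel)"

abbreviation data_law :: "nat \<Rightarrow> real \<Rightarrow> real measure \<Rightarrow> real measure \<Rightarrow> (nat \<Rightarrow> real) measure" where
  "data_law n \<epsilon> P Q \<equiv> Pi\<^sub>M {1..n} (\<lambda>_. contaminate \<epsilon> P Q)"

text \<open>\<open>\<phi> \<theta> \<theta>' \<epsilon>\<close> is the test of the centre \<open>\<theta>\<close> against the alternative centre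
  \<open>\<theta>'\<close> at contamination level \<open>\<epsilon>\<close>; the value \<open>1\<close> means rejection of \<open>\<theta>\<close>.\<close>

definition CI ::
  "(real \<Rightarrow> real \<Rightarrow> real \<Rightarrow> (nat \<Rightarrow> real) \<Rightarrow> nat) \<Rightarrow> (real \<Rightarrow> real) \<Rightarrow> real \<Rightarrow> (nat \<Rightarrow> real) \<Rightarrow> real set"
  where
  "CI \<phi> r \<epsilon>max x =
     {\<theta>. \<forall>\<epsilon>\<in>{0..\<epsilon>max}. \<phi> \<theta> (\<theta> - r \<epsilon>) \<epsilon> x = 0 \<and> \<phi> \<theta> (\<theta> + r \<epsilon>) \<epsilon> x = 0}"

lemma space_contaminate [simp]: "space (contaminate \<epsilon> P Q) = UNIV"
  by (simp add: contaminate_def)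

lemma sets_contaminate [simp, measurable_cong]: "sets (contaminate \<epsilon> P Q) = sets borel"
  by (simp add: contaminate_def sets.sigma_sets_eq[of borel, simplified])

lemma emeasure_contaminate:
  assumes "real_distribution P" "real_distribution Q" "A \<in> sets borel"
  shows "emeasure (contaminate \<epsilon> P Q) A
           = ennreal (1 - \<epsilon>) * emeasure P A + ennreal \<epsilon> * emeasure Q A"
proof (rule emeasure_measure_of[OF contaminate_def])
  interpret P: real_distribution P by fact
  interpret Q: real_distribution Q by fact
  let ?f = "\<lambda>A. ennreal (1 - \<epsilon>) * emeasure P A + ennreal \<epsilon> * emeasure Q A"
  show "countably_additive (sets (contaminate \<epsilon> P Q)) ?f"
  proof (rule countably_additiveI)
    fix B :: "nat \<Rightarrow> real set"
    assume B: "range B \<subseteq> sets (contaminate \<epsilon> P Q)" "disjoint_family B"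
    have "(\<Sum>i. ?f (B i))
        = ennreal (1 - \<epsilon>) * (\<Sum>i. emeasure P (B i)) + ennreal \<epsilon> * (\<Sum>i. emeasure Q (B i))"
      by (simp add: suminf_add[symmetric])
    then show "(\<Sum>i. ?f (B i)) = ?f (\<Union>i. B i)"
      using B by (simp add: suminf_emeasure)
  qed
qed (use assms in \<open>auto simp: positive_def\<close>)

lemma real_distribution_contaminate:
  assumes "real_distribution P" "real_distribution Q" "0 \<le> \<epsilon>" "\<epsilon> \<le> 1"
  shows "real_distribution (contaminate \<epsilon> P Q)"
proof -
  interpret P: real_distribution P by fact
  interpret Q: real_distribution Q by fact
  have "emeasure (contaminate \<epsilon> P Q) UNIV = ennreal (1 - \<epsilon>) + ennreal \<epsilon>"
    using assms P.emeasure_space_1 Q.emeasure_space_1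
    by (simp add: emeasure_contaminate)
  also have "\<dots> = 1"
    using assms by (simp flip: ennreal_plus)
  finally have "prob_space (contaminate \<epsilon> P Q)"
    by (intro prob_spaceI) simp
  then show ?thesis
    by (simp add: real_distribution_def real_distribution_axioms_def)
qed

end

theory Submission
  imports Defs
begin

text \<open>Lowering the contamination level only shrinks the model: for \<open>\<epsilon> \<le> \<epsilon>max\<close> every \<open>P\<^bsub>\<epsilon>,\<theta>,Q\<^esub>\<close> equals
  some \<open>P\<^bsub>\<epsilon>max,\<theta>,Q'\<^esub>\<close>. Hence the simultaneous Type-1 bounds for the two signs give coverage at every
  level. For the length, the tests of \<open>\<theta> \<plusminus> r\<^sub>\<epsilon>\<close> against \<open>\<theta>\<close> reject with probability at least
  \<open>1 - \<alpha>\<close> each, which removes both points from the confidence set; an interval that contains \<open>\<theta>\<close>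
  but neither of \<open>\<theta> \<plusminus> r\<^sub>\<epsilon>\<close> has length at most \<open>2 r\<^sub>\<epsilon>\<close>.\<close>

text \<open>For \<open>\<epsilon>' = 0\<close> the division gives \<open>0\<close>, and both sides are \<open>P\<close>.\<close>

lemma contaminate_eq_contaminate_larger:
  assumes P: "real_distribution P" and Q: "real_distribution Q"
    and "0 \<le> \<epsilon>" "\<epsilon> \<le> \<epsilon>'" "\<epsilon>' \<le> 1"
  shows "contaminate \<epsilon> P Q = contaminate \<epsilon>' P (contaminate (\<epsilon> / \<epsilon>') P Q)"
proof (rule measure_eqI)
  fix A assume "A \<in> sets (contaminate \<epsilon> P Q)"
  then have A: "A \<in> sets borel"
    by simp
  define \<delta> where "\<delta> = \<epsilon> / \<epsilon>'"
  have \<delta>: "0 \<le> \<delta>" "\<delta> \<le> 1" "\<epsilon>' * \<delta> = \<epsilon>"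
    using assms by (auto simp: \<delta>_def divide_simps)
  \<comment> \<open>Expanding the nested mixture leaves weight
    \<open>1 - \<epsilon>' * \<delta>\<close> on \<open>P\<close> and
    \<open>\<epsilon>' * \<delta>\<close> on \<open>Q\<close>; \<delta> is chosen to make the latter
    \<epsilon>.\<close>
  have weight_P: "ennreal (1 - \<epsilon>') + ennreal \<epsilon>' * ennreal (1 - \<delta>) = ennreal (1 - \<epsilon>)"
    using assms \<delta> by (simp add: algebra_simps flip: ennreal_mult ennreal_plus)
  have weight_Q: "ennreal \<epsilon>' * ennreal \<delta> = ennreal \<epsilon>"
    using assms \<delta> by (simp flip: ennreal_mult)
  have "emeasure (contaminate \<epsilon>' P (contaminate \<delta> P Q)) A
      = ennreal (1 - \<epsilon>') * emeasure P A
        + ennreal \<epsilon>' * (ennreal (1 - \<delta>) * emeasure P A + ennreal \<delta> * emeasure Q A)"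
    using P Q A \<delta> by (simp add: emeasure_contaminate real_distribution_contaminate)
  also have "\<dots> = (ennreal (1 - \<epsilon>') + ennreal \<epsilon>' * ennreal (1 - \<delta>)) * emeasure P A
        + (ennreal \<epsilon>' * ennreal \<delta>) * emeasure Q A"
    by (simp add: algebra_simps)
  also have "\<dots> = emeasure (contaminate \<epsilon> P Q) A"
    unfolding weight_P weight_Q using P Q A by (simp add: emeasure_contaminate)
  finally show "emeasure (contaminate \<epsilon> P Q) A
      = emeasure (contaminate \<epsilon>' P (contaminate (\<epsilon> / \<epsilon>') P Q)) A"
    by (simp add: \<delta>_def)
qed simp

lemma sets_data_law: "sets (data_law n \<epsilon> P Q) = sets (data_space n)"
  by (intro sets_PiM_cong) auto

lemma space_data_law: "space (data_law n \<epsilon> P Q) = space (data_space n)"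
  by (rule sets_eq_imp_space_eq[OF sets_data_law])

lemma prob_space_data_law:
  assumes "real_distribution P" "real_distribution Q" "0 \<le> \<epsilon>" "\<epsilon> \<le> 1"
  shows "prob_space (data_law n \<epsilon> P Q)"
  using real_distribution_contaminate[OF assms]
  by (intro prob_space_PiM) (simp add: real_distribution_def)

text \<open>A real supremum dominates its members only for a family bounded above; here
  probabilities are bounded by 1.\<close>

lemma prob_data_law_le_of_SUP_le:
  assumes "real_distribution P" "0 \<le> \<epsilon>" "\<epsilon> \<le> 1" "real_distribution Q"
    and "(SUP Q\<in>{Q. real_distribution Q}. \<P>(x in data_law n \<epsilon> P Q. E x)) \<le> \<alpha>"
  shows "\<P>(x in data_law n \<epsilon> P Q. E x) \<le> \<alpha>"
proof -
  have "bdd_above ((\<lambda>Q. \<P>(x in data_law n \<epsilon> P Q. E x)) ` {Q. real_distribution Q})"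
    using assms(1-3)
    by (intro bdd_aboveI2[where M = 1] prob_space.prob_le_1 prob_space_data_law) simp_all
  then show ?thesis
    using assms(4,5) by (intro order_trans[OF cSUP_upper assms(5)]) simp_all
qed

lemma real_distribution_return: "real_distribution (return borel (x::real))"
  by (auto simp: real_distribution_def real_distribution_axioms_def intro: prob_space_return)

text \<open>With values in a finite set the supremum is a maximum, attained at some
  \<open>b\<close>. Either \<open>f b = 1\<close> and \<open>b\<close> is a witness, or the maximum
  is 0 and no value can be 1.\<close>

lemma SUP_nat_eq_1_iff:
  fixes f :: "'a \<Rightarrow> nat"
  assumes "A \<noteq> {}" and f: "f ` A \<subseteq> {0, 1}"
  shows "(SUP a\<in>A. f a) = 1 \<longleftrightarrow> (\<exists>a\<in>A. f a = 1)"
proof -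
  have "finite (f ` A)"
    using f by (rule finite_subset) simp
  with \<open>A \<noteq> {}\<close> have "Sup (f ` A) \<in> f ` A" and upper: "\<And>a. a \<in> A \<Longrightarrow> f a \<le> Sup (f ` A)"
    using Max_in[of "f ` A"] by (simp_all add: cSup_eq_Max)
  then obtain b where b: "b \<in> A" "Sup (f ` A) = f b"
    by blast
  moreover have "f b \<in> {0, 1}"
    using f b by blast
  ultimately show ?thesis
    using upper by force
qed

text \<open>A point of \<open>I\<close> beyond \<open>c + \<rho>\<close> would force
  \<open>c + \<rho>\<close> itself, lying between it and \<open>c\<close>, into \<open>I\<close>;
  likewise on the left. So \<open>I\<close> is trapped in a closed interval of length
  \<open>2 * \<rho>\<close>.\<close>

lemma emeasure_interval_le:
  fixes I :: "real set"
  assumes I: "is_interval I" and "c \<in> I" "c - \<rho> \<notin> I" "c + \<rho> \<notin> I" and "0 \<le> \<rho>"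
  shows "emeasure lborel I \<le> ennreal (2 * \<rho>)"
proof -
  have "I \<subseteq> {c - \<rho>..c + \<rho>}"
  proof
    fix y assume "y \<in> I"
    with assms have "\<not> y < c - \<rho>" "\<not> c + \<rho> < y"
      using mem_is_interval_1_I[OF I, of y c "c - \<rho>"] mem_is_interval_1_I[OF I, of c y "c + \<rho>"]
      by auto
    then show "y \<in> {c - \<rho>..c + \<rho>}"
      by auto
  qed
  then have "emeasure lborel I \<le> emeasure lborel {c - \<rho>..c + \<rho>}"
    by (rule emeasure_mono) simp
  then show ?thesis
    using \<open>0 \<le> \<rho>\<close> by simp
qed

theorem proposition1:
  fixes n :: nat
    and P :: "real \<Rightarrow> real measure"
    and \<epsilon>max \<alpha> :: real
    and r :: "real \<Rightarrow> real"
    and \<phi> :: "real \<Rightarrow> real \<Rightarrow> real \<Rightarrow> (nat \<Rightarrow> real) \<Rightarrow> nat"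
  assumes model: "\<And>\<theta>. real_distribution (P \<theta>)"
    and \<epsilon>max: "0 \<le> \<epsilon>max" "\<epsilon>max \<le> 1"
    and r_pos: "\<And>\<epsilon>. \<epsilon> \<in> {0..\<epsilon>max} \<Longrightarrow> 0 < r \<epsilon>"
    and \<alpha>: "0 < \<alpha>" "\<alpha> < 1 / 4"
    and tests: "\<And>\<theta> \<epsilon> s. \<epsilon> \<in> {0..\<epsilon>max} \<Longrightarrow> s \<in> {-1, 1} \<Longrightarrow>
        \<phi> \<theta> (\<theta> + s * r \<epsilon>) \<epsilon> \<in> data_space n \<rightarrow>\<^sub>M count_space {0, 1}"
    and type1_event: "\<And>\<theta> s. s \<in> {-1, 1} \<Longrightarrow>
        {x \<in> space (data_space n). (SUP \<epsilon>\<in>{0..\<epsilon>max}. \<phi> \<theta> (\<theta> + s * r \<epsilon>) \<epsilon> x) = 1}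
          \<in> sets (data_space n)"
    and type1: "\<And>\<theta> s. s \<in> {-1, 1} \<Longrightarrow>
        (SUP Q\<in>{Q. real_distribution Q}.
           \<P>(x in data_law n \<epsilon>max (P \<theta>) Q.
             (SUP \<epsilon>\<in>{0..\<epsilon>max}. \<phi> \<theta> (\<theta> + s * r \<epsilon>) \<epsilon> x) = 1)) \<le> \<alpha>"
    and type2: "\<And>\<theta> \<epsilon> s. \<epsilon> \<in> {0..\<epsilon>max} \<Longrightarrow> s \<in> {-1, 1} \<Longrightarrow>
        (SUP Q\<in>{Q. real_distribution Q}.
           \<P>(x in data_law n \<epsilon> (P (\<theta> + s * r \<epsilon>)) Q.
             \<phi> \<theta> (\<theta> + s * r \<epsilon>) \<epsilon> x = 0)) \<le> \<alpha>"
  shows "(INF (\<epsilon>, \<theta>, Q)\<in>{0..\<epsilon>max} \<times> UNIV \<times> {Q. real_distribution Q}.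
            \<P>(x in data_law n \<epsilon> (P \<theta>) Q. \<theta> \<in> CI \<phi> r \<epsilon>max x)) \<ge> 1 - 2 * \<alpha>
       \<and> ((\<forall>x\<in>space (data_space n). is_interval (CI \<phi> r \<epsilon>max x)) \<longrightarrow>
          (\<forall>\<epsilon>\<in>{0..\<epsilon>max}. {x \<in> space (data_space n).
              emeasure lborel (CI \<phi> r \<epsilon>max x) \<le> ennreal (2 * r \<epsilon>)} \<in> sets (data_space n)) \<longrightarrow>
          (INF (\<epsilon>, \<theta>, Q)\<in>{0..\<epsilon>max} \<times> UNIV \<times> {Q. real_distribution Q}.
            \<P>(x in data_law n \<epsilon> (P \<theta>) Q.
              emeasure lborel (CI \<phi> r \<epsilon>max x) \<le> ennreal (2 * r \<epsilon>))) \<ge> 1 - 4 * \<alpha>)"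
proof -
  \<comment> \<open>\<open>R\<close> is the Type-1 event (some level rejects \<theta> in direction
    \<open>s\<close>), \<open>M\<close> the Type-2 event (the test at level \<epsilon> misses). Both
    live on \<open>data_space n\<close>, whose events all the data laws share.\<close>
  define R where "R = (\<lambda>\<theta> s. {x \<in> space (data_space n).
    (SUP \<epsilon>\<in>{0..\<epsilon>max}. \<phi> \<theta> (\<theta> + s * r \<epsilon>) \<epsilon> x) = 1})"
  define M where "M = (\<lambda>\<epsilon> \<theta> s. {x \<in> space (data_space n). \<phi> \<theta> (\<theta> + s * r \<epsilon>) \<epsilon> x = 0})"

  \<comment> \<open>Measurability into \<open>count_space {0, 1}\<close> also encodes that the tests
    take only these two values.\<close>
  have range: "\<phi> \<theta> (\<theta> + s * r \<epsilon>) \<epsilon> x \<in> {0, 1}"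
    if "x \<in> space (data_space n)" "\<epsilon> \<in> {0..\<epsilon>max}" "s \<in> {-1, 1}" for \<theta> s \<epsilon> x
    using measurable_space[OF tests[OF that(2,3)] that(1)] by simp

  have R_sets: "R \<theta> s \<in> sets (data_law n \<epsilon> (P \<theta>') Q)" if "s \<in> {-1, 1}" for \<theta> s \<epsilon> \<theta>' Q
    using type1_event[OF that] unfolding R_def sets_data_law .

  have M_sets: "M \<epsilon> \<theta> s \<in> sets (data_law n \<epsilon>' (P \<theta>') Q)"
    if "\<epsilon> \<in> {0..\<epsilon>max}" "s \<in> {-1, 1}" for \<theta> s \<epsilon> \<epsilon>' \<theta>' Q
  proof -
    have "\<phi> \<theta> (\<theta> + s * r \<epsilon>) \<epsilon> -` {0} \<inter> space (data_space n) \<in> sets (data_space n)"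
      by (rule measurable_sets[OF tests[OF that]]) simp
    also have "\<phi> \<theta> (\<theta> + s * r \<epsilon>) \<epsilon> -` {0} \<inter> space (data_space n) = M \<epsilon> \<theta> s"
      by (auto simp: M_def)
    finally show ?thesis
      unfolding sets_data_law .
  qed

  \<comment> \<open>This replaces a condition over a continuum of levels by two events that are
    measurable by assumption.\<close>
  have CI_iff: "\<theta> \<in> CI \<phi> r \<epsilon>max x \<longleftrightarrow> x \<notin> R \<theta> (-1) \<union> R \<theta> 1"
    if x: "x \<in> space (data_space n)" for \<theta> x
  proof -
    have "x \<in> R \<theta> s \<longleftrightarrow> (\<exists>\<epsilon>\<in>{0..\<epsilon>max}. \<phi> \<theta> (\<theta> + s * r \<epsilon>) \<epsilon> x \<noteq> 0)" if "s \<in> {-1, 1}" for s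
    proof -
      have "(SUP \<epsilon>\<in>{0..\<epsilon>max}. \<phi> \<theta> (\<theta> + s * r \<epsilon>) \<epsilon> x) = 1
          \<longleftrightarrow> (\<exists>\<epsilon>\<in>{0..\<epsilon>max}. \<phi> \<theta> (\<theta> + s * r \<epsilon>) \<epsilon> x = 1)"
        using \<epsilon>max(1) range[OF x _ that] by (intro SUP_nat_eq_1_iff image_subsetI) simp_all
      moreover have "\<phi> \<theta> (\<theta> + s * r \<epsilon>) \<epsilon> x = 1 \<longleftrightarrow> \<phi> \<theta> (\<theta> + s * r \<epsilon>) \<epsilon> x \<noteq> 0"
        if "\<epsilon> \<in> {0..\<epsilon>max}" for \<epsilon>
        using range[OF x that \<open>s \<in> {-1, 1}\<close>, of \<theta>] by auto
      ultimately show ?thesis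
        using x by (simp add: R_def)
    qed
    from this[of "-1"] this[of 1] show ?thesis
      by (auto simp: CI_def)
  qed

  have R_le: "measure (data_law n \<epsilon> (P \<theta>) Q) (R \<theta> s) \<le> \<alpha>"
    if "\<epsilon> \<in> {0..\<epsilon>max}" "real_distribution Q" "s \<in> {-1, 1}" for \<epsilon> \<theta> Q s
  proof -
    \<comment> \<open>The Type-1 bound is given only at level \<epsilon>max, but for every
      contamination. The law at level \<epsilon> is moved there by absorbing part of the mass of
      \<open>P \<theta>\<close> into the contamination \<open>?Q'\<close>.\<close>
    let ?Q' = "contaminate (\<epsilon> / \<epsilon>max) (P \<theta>) Q"
    have eq: "contaminate \<epsilon> (P \<theta>) Q = contaminate \<epsilon>max (P \<theta>) ?Q'"
      using that model \<epsilon>max by (intro contaminate_eq_contaminate_larger) auto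
    have "real_distribution ?Q'"
      using that model \<epsilon>max by (intro real_distribution_contaminate) (auto simp: divide_simps)
    from prob_data_law_le_of_SUP_le[OF model \<epsilon>max this type1[OF that(3)]]
    show ?thesis
      unfolding eq R_def space_data_law .
  qed

  have M_le: "measure (data_law n \<epsilon> (P (\<theta> + s * r \<epsilon>)) Q) (M \<epsilon> \<theta> s) \<le> \<alpha>"
    if "\<epsilon> \<in> {0..\<epsilon>max}" "real_distribution Q" "s \<in> {-1, 1}" for \<epsilon> \<theta> Q s
    using prob_data_law_le_of_SUP_le[OF model _ _ that(2) type2[OF that(1,3)]] that(1) \<epsilon>max
    unfolding M_def space_data_law by auto

  have coverage: "1 - 2 * \<alpha> \<le> \<P>(x in data_law n \<epsilon> (P \<theta>) Q. \<theta> \<in> CI \<phi> r \<epsilon>max x)"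
    if "\<epsilon> \<in> {0..\<epsilon>max}" "real_distribution Q" for \<epsilon> \<theta> Q
  proof -
    interpret L: prob_space "data_law n \<epsilon> (P \<theta>) Q"
      using that model \<epsilon>max by (intro prob_space_data_law) auto
    \<comment> \<open>The union bound over the two directions costs \<alpha> each.\<close>
    have "L.prob (R \<theta> (-1) \<union> R \<theta> 1) \<le> L.prob (R \<theta> (-1)) + L.prob (R \<theta> 1)"
      by (intro measure_Un_le R_sets) auto
    also have "\<dots> \<le> 2 * \<alpha>"
      using R_le[OF that, of "-1" \<theta>] R_le[OF that, of 1 \<theta>] by simp
    finally have "L.prob (R \<theta> (-1) \<union> R \<theta> 1) \<le> 2 * \<alpha>" .
    moreover have "{x \<in> space (data_law n \<epsilon> (P \<theta>) Q). \<theta> \<in> CI \<phi> r \<epsilon>max x}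
        = space (data_law n \<epsilon> (P \<theta>) Q) - (R \<theta> (-1) \<union> R \<theta> 1)"
      using CI_iff unfolding space_data_law by blast
    moreover have "R \<theta> (-1) \<union> R \<theta> 1 \<in> L.events"
      by (intro sets.Un R_sets) auto
    ultimately show ?thesis
      by (simp only: L.prob_compl)
  qed

  have length: "1 - 4 * \<alpha> \<le> \<P>(x in data_law n \<epsilon> (P \<theta>) Q.
      emeasure lborel (CI \<phi> r \<epsilon>max x) \<le> ennreal (2 * r \<epsilon>))"
    if interval: "\<forall>x\<in>space (data_space n). is_interval (CI \<phi> r \<epsilon>max x)"
      and event: "\<forall>\<epsilon>\<in>{0..\<epsilon>max}. {x \<in> space (data_space n).
        emeasure lborel (CI \<phi> r \<epsilon>max x) \<le> ennreal (2 * r \<epsilon>)} \<in> sets (data_space n)"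
      and \<epsilon>: "\<epsilon> \<in> {0..\<epsilon>max}" and Q: "real_distribution Q" for \<epsilon> \<theta> Q
  proof -
    let ?L = "data_law n \<epsilon> (P \<theta>) Q"
    interpret L: prob_space ?L
      using \<epsilon> Q model \<epsilon>max by (intro prob_space_data_law) auto
    let ?R = "R \<theta> (-1) \<union> R \<theta> 1"
    \<comment> \<open>The signs point inwards: from either tested centre the alternative is the true
      \<theta>, so \<open>M_le\<close> applies under this law. Two events in \<open>?R\<close> and
      two in \<open>?M\<close> give \<open>4 * \<alpha>\<close>.\<close>
    let ?M = "M \<epsilon> (\<theta> - r \<epsilon>) 1 \<union> M \<epsilon> (\<theta> + r \<epsilon>) (-1)"
    have R: "?R \<in> L.events"
      by (intro sets.Un R_sets) auto
    have M: "?M \<in> L.events"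
      by (intro sets.Un M_sets \<epsilon>) auto
    have "L.prob ?R \<le> L.prob (R \<theta> (-1)) + L.prob (R \<theta> 1)"
      by (intro measure_Un_le R_sets) auto
    moreover have "L.prob ?M \<le> L.prob (M \<epsilon> (\<theta> - r \<epsilon>) 1) + L.prob (M \<epsilon> (\<theta> + r \<epsilon>) (-1))"
      by (intro measure_Un_le M_sets \<epsilon>) auto
    moreover have "L.prob (?R \<union> ?M) \<le> L.prob ?R + L.prob ?M"
      by (intro measure_Un_le R M)
    ultimately have "L.prob (?R \<union> ?M) \<le> 4 * \<alpha>"
      using R_le[OF \<epsilon> Q, of "-1" \<theta>] R_le[OF \<epsilon> Q, of 1 \<theta>]
        M_le[OF \<epsilon> Q, of 1 "\<theta> - r \<epsilon>"] M_le[OF \<epsilon> Q, of "-1" "\<theta> + r \<epsilon>"]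
      by simp
    then have "1 - 4 * \<alpha> \<le> L.prob (space ?L - (?R \<union> ?M))"
      by (simp only: L.prob_compl[OF sets.Un[OF R M]])
    \<comment> \<open>Off the four bad events the confidence set contains \<theta> and omits both
      shifted centres. Monotonicity requires the length event to be measurable, which is the
      assumption \<open>event\<close>.\<close>
    also have "\<dots> \<le> L.prob {x \<in> space ?L. emeasure lborel (CI \<phi> r \<epsilon>max x) \<le> ennreal (2 * r \<epsilon>)}"
    proof (rule L.finite_measure_mono)
      show "{x \<in> space ?L. emeasure lborel (CI \<phi> r \<epsilon>max x) \<le> ennreal (2 * r \<epsilon>)} \<in> L.events"
        using event \<epsilon> unfolding space_data_law sets_data_law by blast
      show "space ?L - (?R \<union> ?M)
          \<subseteq> {x \<in> space ?L. emeasure lborel (CI \<phi> r \<epsilon>max x) \<le> ennreal (2 * r \<epsilon>)}"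
      proof
        fix x assume x: "x \<in> space ?L - (?R \<union> ?M)"
        then have xs: "x \<in> space (data_space n)"
          by (simp only: space_data_law Diff_iff)
        have "\<theta> \<in> CI \<phi> r \<epsilon>max x"
          using x CI_iff[OF xs] by blast
        \<comment> \<open>The alternatives, both equal to \<theta>, stay unsimplified to match
          \<open>CI_def\<close> at the shifted centres.\<close>
        moreover have "\<phi> (\<theta> - r \<epsilon>) (\<theta> - r \<epsilon> + r \<epsilon>) \<epsilon> x \<noteq> 0"
            "\<phi> (\<theta> + r \<epsilon>) (\<theta> + r \<epsilon> - r \<epsilon>) \<epsilon> x \<noteq> 0"
          using x xs by (simp_all add: M_def)
        then have "\<theta> - r \<epsilon> \<notin> CI \<phi> r \<epsilon>max x" "\<theta> + r \<epsilon> \<notin> CI \<phi> r \<epsilon>max x"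
          using \<epsilon> unfolding CI_def mem_Collect_eq by metis+
        ultimately have "emeasure lborel (CI \<phi> r \<epsilon>max x) \<le> ennreal (2 * r \<epsilon>)"
          using interval xs r_pos[OF \<epsilon>] by (intro emeasure_interval_le[of _ \<theta>]) auto
        then show "x \<in> {x \<in> space ?L. emeasure lborel (CI \<phi> r \<epsilon>max x) \<le> ennreal (2 * r \<epsilon>)}"
          using x by blast
      qed
    qed
    finally show ?thesis .
  qed

  \<comment> \<open>A pointwise lower bound passes to a real infimum only over a nonempty index set;
    the point mass at 0 supplies a contamination.\<close>
  have "(0, 0, return borel 0) \<in> {0..\<epsilon>max} \<times> (UNIV :: real set) \<times> {Q. real_distribution Q}"
    using \<epsilon>max real_distribution_return by auto
  then have nonempty: "{0..\<epsilon>max} \<times> (UNIV :: real set) \<times> {Q. real_distribution Q} \<noteq> {}"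
    by blast
  show ?thesis
  proof (intro conjI impI cINF_greatest[OF nonempty]; clarify)
    fix \<epsilon> \<theta> :: real and Q assume "\<epsilon> \<in> {0..\<epsilon>max}" "real_distribution Q"
    then show "1 - 2 * \<alpha> \<le> \<P>(x in data_law n \<epsilon> (P \<theta>) Q. \<theta> \<in> CI \<phi> r \<epsilon>max x)"
      by (rule coverage)
  next
    fix \<epsilon> \<theta> :: real and Q
    assume "\<forall>x\<in>space (data_space n). is_interval (CI \<phi> r \<epsilon>max x)"
      and "\<forall>\<epsilon>\<in>{0..\<epsilon>max}. {x \<in> space (data_space n).
        emeasure lborel (CI \<phi> r \<epsilon>max x) \<le> ennreal (2 * r \<epsilon>)} \<in> sets (data_space n)"
      and "\<epsilon> \<in> {0..\<epsilon>max}" "real_distribution Q"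
    then show "1 - 4 * \<alpha> \<le> \<P>(x in data_law n \<epsilon> (P \<theta>) Q.
        emeasure lborel (CI \<phi> r \<epsilon>max x) \<le> ennreal (2 * r \<epsilon>))"
      by (rule length)
  qed
qed

end
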